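(* Let $X$ be a strongly $0$-dimensional metrizable space. Let $R$ be a dense subset of $[0,\infty)$ with $0\in R$. Then the following subsets of $\mathrm{Met}(X)$ are meager in $\mathrm{Met}(X)$: (1) the set of all $\mathscr{F}$-universal metrics in $\mathrm{Met}(X)$; (2) the set of all metrics $d\in\mathrm{Met}(X)$ such that $(X,d)$ is an $\mathscr{N}(R)$-injective ultrametric space.
   Context: A topological space $X$ is strongly $0$-dimensional if for every pair $A, B$ of disjoint closed subsets of $X$ there exists a clopen set $V$ with $A\subset V$ and $V\cap B=\emptyset$. For a metrizable space $X$, $\mathrm{Met}(X)$ denotes the set of all metrics on $X$ that generate the given topology of $X$, with the topology generated by the open balls of the $[0,\infty]$-valued metric $\mathcal{D}_{X}(d,e)=\sup_{x,y\in X}|d(x,y)-e(x,y)|$. A metric $d$ on $X$ is an ultrametric if $d(x,y)\le\max\{d(x,z),d(z,y)\}$ for all $x,y,z\in X$. For a class $\mathscr{M}$ of metric spaces, a metric space $(X,d)$ (and also the metric $d$) is $\mathscr{M}$-universal if every $(Y,e)\in\mathscr{M}$ admits an isometric embedding into $(X,d)$. $\mathscr{F}$ is the class of all finite metric spaces. $\mathscr{N}(R)$ is the class of all finite ultrametric spaces whose metrics take values in $R$. For a class $\mathscr{M}$ of finite metric spaces, a metric space $(X,d)$ is $\mathscr{M}$-injective if for every $(A,m)\in\mathscr{M}$ and every subset $B\subset A$ (possibly empty), every isometric embedding $\phi\colon(B,m|_{B^{2}})\to(X,d)$ can be extended to an isometric embedding $\Phi\colon(A,m)\to(X,d)$. A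 subset of a topological space is meager if it is a countable union of nowhere dense subsets. *)

theory Defs
  imports "HOL-Analysis.Analysis"
begin

definition strongly_zero_dimensional :: "'a topology \<Rightarrow> bool" where
  "strongly_zero_dimensional X \<longleftrightarrow>
     (\<forall>A B. closedin X A \<and> closedin X B \<and> A \<inter> B = {} \<longrightarrow>
        (\<exists>V. openin X V \<and> closedin X V \<and> A \<subseteq> V \<and> V \<inter> B = {}))"

text \<open>A metric on \<^term>\<open>topspace X\<close> is a total function on \<^typ>\<open>'a\<close>, of which only the values on
  the carrier matter.  The values off the carrier are fixed to be \<open>0\<close>, so that each metric on the
  space is represented by exactly one function.\<close>

definition Met :: "'a topology \<Rightarrow> ('a \<Rightarrow> 'a \<Rightarrow> real) set" where
  "Met X = {d. Metric_space (topspace X) d \<and> Metric_space.mtopology (topspace X) d = X \<and>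
               (\<forall>x y. x \<notin> topspace X \<or> y \<notin> topspace X \<longrightarrow> d x y = 0)}"

definition Met_dist ::
    "'a topology \<Rightarrow> ('a \<Rightarrow> 'a \<Rightarrow> real) \<Rightarrow> ('a \<Rightarrow> 'a \<Rightarrow> real) \<Rightarrow> ennreal" where
  "Met_dist X d e = (SUP x\<in>topspace X. SUP y\<in>topspace X. ennreal \<bar>d x y - e x y\<bar>)"

definition Met_ball :: "'a topology \<Rightarrow> ('a \<Rightarrow> 'a \<Rightarrow> real) \<Rightarrow> real \<Rightarrow> ('a \<Rightarrow> 'a \<Rightarrow> real) set" where
  "Met_ball X d r = {e \<in> Met X. Met_dist X d e < ennreal r}"

definition Met_topology :: "'a topology \<Rightarrow> ('a \<Rightarrow> 'a \<Rightarrow> real) topology" where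
  "Met_topology X = topology_generated_by {Met_ball X d r | d r. d \<in> Met X \<and> 0 < r}"

definition nowhere_dense_in :: "'a topology \<Rightarrow> 'a set \<Rightarrow> bool" where
  "nowhere_dense_in T S \<longleftrightarrow> S \<subseteq> topspace T \<and> T interior_of (T closure_of S) = {}"

definition meager_in :: "'a topology \<Rightarrow> 'a set \<Rightarrow> bool" where
  "meager_in T S \<longleftrightarrow> (\<exists>N :: nat \<Rightarrow> 'a set. (\<forall>n. nowhere_dense_in T (N n)) \<and> S = (\<Union>n. N n))"

definition ultrametric_on :: "'a set \<Rightarrow> ('a \<Rightarrow> 'a \<Rightarrow> real) \<Rightarrow> bool" where
  "ultrametric_on M d \<longleftrightarrow> Metric_space M d \<and>
     (\<forall>x\<in>M. \<forall>y\<in>M. \<forall>z\<in>M. d x y \<le> max (d x z) (d z y))"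

definition isometric_embedding ::
    "'b set \<Rightarrow> ('b \<Rightarrow> 'b \<Rightarrow> real) \<Rightarrow> 'a set \<Rightarrow> ('a \<Rightarrow> 'a \<Rightarrow> real) \<Rightarrow> ('b \<Rightarrow> 'a) \<Rightarrow> bool" where
  "isometric_embedding Y e M d \<phi> \<longleftrightarrow>
     \<phi> \<in> Y \<rightarrow> M \<and> (\<forall>x\<in>Y. \<forall>y\<in>Y. d (\<phi> x) (\<phi> y) = e x y)"

definition universal_for ::
    "('b set \<times> ('b \<Rightarrow> 'b \<Rightarrow> real)) set \<Rightarrow> 'a set \<Rightarrow> ('a \<Rightarrow> 'a \<Rightarrow> real) \<Rightarrow> bool" where
  "universal_for \<M> M d \<longleftrightarrow> (\<forall>(Y, e)\<in>\<M>. \<exists>\<phi>. isometric_embedding Y e M d \<phi>)"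

definition injective_for ::
    "('b set \<times> ('b \<Rightarrow> 'b \<Rightarrow> real)) set \<Rightarrow> 'a set \<Rightarrow> ('a \<Rightarrow> 'a \<Rightarrow> real) \<Rightarrow> bool" where
  "injective_for \<M> M d \<longleftrightarrow>
     (\<forall>(A, m)\<in>\<M>. \<forall>B \<subseteq> A. \<forall>\<phi>. isometric_embedding B m M d \<phi> \<longrightarrow>
        (\<exists>\<Phi>. isometric_embedding A m M d \<Phi> \<and> (\<forall>b\<in>B. \<Phi> b = \<phi> b)))"

text \<open>A class of finite metric spaces ranging over all carriers is not a set in HOL.  Every finite
  metric space is isometric to one whose points are natural numbers, and universality and
  injectivity depend only on the isometry types occurring in the class, so the carriers are taken
  to be finite sets of naturals.  The empty space is included.\<close>

definition finite_metric_spaces :: "(nat set \<times> (nat \<Rightarrow> nat \<Rightarrow> real)) set" where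
  "finite_metric_spaces = {(A, m). finite A \<and> Metric_space A m}"

definition finite_ultrametric_spaces :: "real set \<Rightarrow> (nat set \<times> (nat \<Rightarrow> nat \<Rightarrow> real)) set" where
  "finite_ultrametric_spaces R =
     {(A, m). finite A \<and> ultrametric_on A m \<and> (\<forall>x\<in>A. \<forall>y\<in>A. m x y \<in> R)}"

end

theory Submission
  imports Defs
begin

text \<open>Both sets lie in the complement of the set of metrics whose values miss some nonempty open
  interval of \<open>[0, \<infinity>)\<close>, since their members attain a dense set of distances. Metrics with
  such a gap form an open set, and this set is dense: by strong zero-dimensionality there is a
  locally constant \<open>f\<close> moving points by less than \<open>\<epsilon>\<close>; truncate \<open>d\<close> at \<open>\<epsilon>/2\<close> on the fibres of
  \<open>f\<close> and round \<open>d (f x) (f y)\<close> up to a multiple of \<open>\<epsilon>\<close> between different fibres, so that no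
  value falls between \<open>\<epsilon>/2\<close> and \<open>\<epsilon>\<close>.\<close>

section \<open>Locally constant maps close to the identity\<close>

text \<open>A zero-dimensional version of Rudin's proof of Stone's theorem: each point is sent to the first
  center, in a well-ordering, whose \<open>\<epsilon>\<close>-ball contains it, and clopen sets are used to make
  this choice locally constant.\<close>

lemma (in Metric_space) locally_constant_approximation:
  assumes X: "strongly_zero_dimensional mtopology" and e: "0 < \<epsilon>"
  obtains f where "\<And>x. x \<in> M \<Longrightarrow> f x \<in> M" "\<And>x. x \<in> M \<Longrightarrow> d (f x) x < \<epsilon>"
    "\<And>x. x \<in> M \<Longrightarrow> \<exists>\<delta>>0. \<forall>y\<in>mball x \<delta>. f y = f x"
proof -
  obtain r :: "'a rel" where r: "well_order_on UNIV r"
    using well_order_on by blast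
  have wf: "wf (r - Id)" and tot: "total r" and anti: "antisym r"
    using r by (auto simp: well_order_on_def linear_order_on_def partial_order_on_def)
  have "\<exists>\<alpha>. \<alpha> \<in> M \<and> d \<alpha> x < \<epsilon> \<and> (\<forall>\<beta>\<in>M. d \<beta> x < \<epsilon> \<longrightarrow> \<alpha> = \<beta> \<or> (\<alpha>, \<beta>) \<in> r)" if x: "x \<in> M" for x
  proof -
    have "x \<in> {\<alpha> \<in> M. d \<alpha> x < \<epsilon>}" using x e by simp
    then obtain z where z: "z \<in> {\<alpha> \<in> M. d \<alpha> x < \<epsilon>}"
      and zm: "\<And>y. (y, z) \<in> r - Id \<Longrightarrow> y \<notin> {\<alpha> \<in> M. d \<alpha> x < \<epsilon>}"
      by (rule wfE_min[OF wf]) blast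
    have "z = \<beta> \<or> (z, \<beta>) \<in> r" if b: "\<beta> \<in> M" "d \<beta> x < \<epsilon>" for \<beta>
    proof -
      have "(\<beta>, z) \<notin> r - Id" using b zm[of \<beta>] by blast
      then show ?thesis using tot by (auto simp: total_on_def)
    qed
    then show ?thesis using z by blast
  qed
  then obtain c where cM: "\<And>x. x \<in> M \<Longrightarrow> c x \<in> M" and cd: "\<And>x. x \<in> M \<Longrightarrow> d (c x) x < \<epsilon>"
    and cmin: "\<And>x \<beta>. x \<in> M \<Longrightarrow> \<beta> \<in> M \<Longrightarrow> d \<beta> x < \<epsilon> \<Longrightarrow> c x = \<beta> \<or> (c x, \<beta>) \<in> r"
    by metis
  define h where "h n = inverse (real (Suc n))" for n
  have h0: "0 < h n" for n by (simp add: h_def)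
  \<comment> \<open>These points have a margin \<open>h n\<close> inside the ball of their first
    center. If two of them are closer than \<open>h n\<close>, each lies in the ball of the other's
    center, so minimality both ways and antisymmetry make the centers equal.\<close>
  define A where "A n = {x \<in> M. mball x (h n) \<subseteq> mball (c x) \<epsilon>}" for n
  have AM: "A n \<subseteq> M" for n by (auto simp: A_def)
  have sep: "c x = c y" if xy: "x \<in> A n" "y \<in> A n" "d x y < h n" for x y n
  proof -
    have "y \<in> mball x (h n)" "x \<in> mball y (h n)" using xy by (auto simp: A_def commute)
    then have "y \<in> mball (c x) \<epsilon>" "x \<in> mball (c y) \<epsilon>" using xy by (auto simp: A_def)
    then have "c y = c x \<or> (c y, c x) \<in> r" "c x = c y \<or> (c x, c y) \<in> r"
      using cmin[of y "c x"] cmin[of x "c y"] by auto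
    then show ?thesis using anti by (auto dest: antisymD)
  qed
  \<comment> \<open>The radius is halved so that two points of \<open>A n\<close> within
    \<open>h n / 2\<close> of a common point are less than \<open>h n\<close> apart and share their
    center. A clopen set then fits between the closure of \<open>A n\<close> and
    \<open>W n\<close>.\<close>
  define W where "W n = (\<Union>a\<in>A n. mball a (h n / 2))" for n
  have "\<exists>V. openin mtopology V \<and> closedin mtopology V \<and> mtopology closure_of A n \<subseteq> V
      \<and> V \<inter> (topspace mtopology - W n) = {}" for n
  proof -
    have "openin mtopology (W n)" unfolding W_def by blast
    then have "closedin mtopology (topspace mtopology - W n)" by blast
    moreover have "mtopology closure_of A n \<subseteq> W n"
    proof
      fix x assume "x \<in> mtopology closure_of A n"
      then obtain y where "y \<in> A n" "y \<in> mball x (h n / 2)" "x \<in> M"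
        unfolding metric_closure_of using half_gt_zero[OF h0[of n]] by blast
      then show "x \<in> W n" by (auto simp: W_def commute intro!: bexI[of _ y])
    qed
    ultimately show ?thesis
      using X[unfolded strongly_zero_dimensional_def, rule_format,
          of "mtopology closure_of A n" "topspace mtopology - W n"] by auto
  qed
  then obtain V where V: "\<And>n. openin mtopology (V n)" "\<And>n. closedin mtopology (V n)"
    "\<And>n. mtopology closure_of A n \<subseteq> V n" "\<And>n. V n \<inter> (topspace mtopology - W n) = {}"
    by metis
  have AV: "A n \<subseteq> V n" for n
    using V(3)[of n] closure_of_subset[of "A n" mtopology] AM[of n] by auto
  have VW: "V n \<subseteq> W n" for n
    using V(4)[of n] openin_subset[OF V(1)[of n]] by auto
  have cover: "\<exists>n. x \<in> V n" if x: "x \<in> M" for x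
  proof -
    have "x \<in> mball (c x) \<epsilon>" using x cM cd by simp
    then obtain s where s: "s > 0" "mball x s \<subseteq> mball (c x) \<epsilon>"
      using openin_mball[of "c x" \<epsilon>] unfolding openin_mtopology by blast
    obtain n where n: "h n < s" using reals_Archimedean[OF s(1)] by (auto simp: h_def)
    have "mball x (h n) \<subseteq> mball (c x) \<epsilon>" using s n mball_subset_concentric[of "h n" s x] by auto
    then have "x \<in> A n" using x by (simp add: A_def)
    then show ?thesis using AV by blast
  qed
  \<comment> \<open>\<open>N x\<close> picks the first clopen set around \<open>x\<close>. The
    witness \<open>a x\<close> is an arbitrary choice and may vary from point to point; only its
    center \<open>c (a x)\<close> will be locally constant.\<close>
  define N where "N x = (LEAST n. x \<in> V n)" for x
  define a where "a x = (SOME a. a \<in> A (N x) \<and> d a x < h (N x) / 2)" for x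
  have NV: "x \<in> V (N x)" if "x \<in> M" for x
    using cover[OF that] unfolding N_def by (rule LeastI_ex)
  have not_before_N: "x \<notin> V m" if "m < N x" for m x
    using that unfolding N_def by (rule not_less_Least)
  have a: "a x \<in> A (N x)" "d (a x) x < h (N x) / 2" if "x \<in> M" for x
  proof -
    have "x \<in> W (N x)" using NV[OF that] VW by blast
    then have "\<exists>b. b \<in> A (N x) \<and> d b x < h (N x) / 2" by (auto simp: W_def)
    from someI_ex[OF this] show "a x \<in> A (N x)" "d (a x) x < h (N x) / 2"
      by (auto simp: a_def)
  qed
  have aM: "a x \<in> M" if "x \<in> M" for x using a(1)[OF that] AM by blast
  show thesis
  proof (rule that[of "\<lambda>x. c (a x)"])
    fix x assume x: "x \<in> M"
    show "c (a x) \<in> M" using aM[OF x] cM by blast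
    have "x \<in> mball (a x) (h (N x))" using a(2)[OF x] aM[OF x] x h0[of "N x"] by auto
    then have "x \<in> mball (c (a x)) \<epsilon>" using a(1)[OF x] by (auto simp: A_def)
    then show "d (c (a x)) x < \<epsilon>" by simp
    \<comment> \<open>Only finitely many clopen sets are removed, so \<open>?U\<close> is open, and
      \<open>N\<close> is constant on it. The ball keeps \<open>a x\<close> within
      \<open>h (N x) / 2\<close> of each \<open>y\<close> in \<open>?U\<close>, which brings
      \<open>a y\<close> and \<open>a x\<close> within the range of \<open>sep\<close>.\<close>
    let ?U = "(V (N x) - (\<Union>m<N x. V m)) \<inter> mball (a x) (h (N x) / 2)"
    have "closedin mtopology (\<Union>m<N x. V m)" by (rule closedin_Union) (auto simp: V)
    then have "openin mtopology ?U" using V(1) by blast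
    moreover have "x \<in> ?U"
      using NV[OF x] x aM[OF x] a(2)[OF x] not_before_N[of _ x] by auto
    ultimately obtain \<delta> where \<delta>: "\<delta> > 0" "mball x \<delta> \<subseteq> ?U"
      unfolding openin_mtopology by blast
    have "c (a y) = c (a x)" if "y \<in> mball x \<delta>" for y
    proof -
      have yU: "y \<in> ?U" using that \<delta> by blast
      then have y: "y \<in> M" by auto
      have Ny: "N y = N x" unfolding N_def[of y]
      proof (rule Least_equality)
        show "N x \<le> m" if "y \<in> V m" for m
          using \<open>y \<in> V m\<close> yU not_le_imp_less by blast
      qed (use yU in blast)
      have "d (a y) (a x) \<le> d (a y) y + d (a x) y"
        using triangle[of "a y" y "a x"] aM x y by (simp add: commute)
      also have "\<dots> < h (N x)" using a(2)[OF y] yU Ny by auto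
      finally show ?thesis using sep[of "a y" "N x" "a x"] a(1)[OF y] a(1)[OF x] Ny by simp
    qed
    then show "\<exists>\<delta>>0. \<forall>y\<in>mball x \<delta>. c (a y) = c (a x)" using \<delta> by blast
  qed
qed

section \<open>Equality of metric topologies, and the topology of the space of metrics\<close>

text \<open>Openness is tested by arbitrarily small balls, and around each point all balls of radius
  at most \<open>\<delta>\<close> coincide. The bound \<open>\<delta>\<close> may depend on the
  point.\<close>

lemma mtopology_eq_if_locally_agree:
  assumes d: "Metric_space M d" and e: "Metric_space M e"
    and agree: "\<And>x. x \<in> M \<Longrightarrow> \<exists>\<delta>>0. \<forall>s\<le>\<delta>. \<forall>y\<in>M. d x y < s \<longleftrightarrow> e x y < s"
  shows "Metric_space.mtopology M d = Metric_space.mtopology M e"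
proof -
  interpret D: Metric_space M d by fact
  interpret E: Metric_space M e by fact
  have "(\<exists>s>0. D.mball x s \<subseteq> U) \<longleftrightarrow> (\<exists>s>0. E.mball x s \<subseteq> U)" if x: "x \<in> M" for x U
  proof -
    obtain \<delta> where \<delta>: "\<delta> > 0" "\<And>s y. s \<le> \<delta> \<Longrightarrow> y \<in> M \<Longrightarrow> d x y < s \<longleftrightarrow> e x y < s"
      using agree[OF x] by blast
    have eq: "D.mball x (min s \<delta>) = E.mball x (min s \<delta>)" for s
      using \<delta>(2)[of "min s \<delta>"] x
      by (intro set_eqI) (auto simp del: min_less_iff_conj)
    have "D.mball x (min s \<delta>) \<subseteq> D.mball x s" "E.mball x (min s \<delta>) \<subseteq> E.mball x s" for s
      by (auto simp: D.mball_subset_concentric E.mball_subset_concentric)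
    then show ?thesis using eq \<delta>(1) by (metis min_less_iff_conj subset_trans)
  qed
  then show ?thesis
    unfolding topology_eq D.openin_mtopology E.openin_mtopology by blast
qed

text \<open>A supremum lies strictly below \<open>r\<close> exactly when some \<open>t < r\<close>
  bounds all terms. This trades the extended-real distance for real inequalities with a uniform
  slack \<open>r - t\<close>.\<close>

lemma mem_Met_ball_iff:
  "e \<in> Met_ball X d r \<longleftrightarrow>
     e \<in> Met X \<and> (\<exists>t\<ge>0. t < r \<and> (\<forall>x\<in>topspace X. \<forall>y\<in>topspace X. \<bar>d x y - e x y\<bar> \<le> t))"
proof -
  have *: "Met_dist X d e \<le> ennreal t \<longleftrightarrow>
      (\<forall>x\<in>topspace X. \<forall>y\<in>topspace X. \<bar>d x y - e x y\<bar> \<le> t)" if "t \<ge> 0" for t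
    using that by (simp add: Met_dist_def SUP_le_iff)
  have "Met_dist X d e < ennreal r \<longleftrightarrow> (\<exists>t\<ge>0. t < r \<and> Met_dist X d e \<le> ennreal t)"
  proof
    assume less: "Met_dist X d e < ennreal r"
    then obtain t where "t \<ge> 0" "Met_dist X d e = ennreal t"
      by (cases "Met_dist X d e") auto
    then show "\<exists>t\<ge>0. t < r \<and> Met_dist X d e \<le> ennreal t"
      using less by (metis ennreal_less_iff order_refl)
  next
    assume "\<exists>t\<ge>0. t < r \<and> Met_dist X d e \<le> ennreal t"
    then show "Met_dist X d e < ennreal r"
      by (metis ennreal_lessI le_less_trans)
  qed
  then show ?thesis using * by (auto simp: Met_ball_def)
qed

text \<open>The balls generate the topology only as a subbase; the triangle inequality for the
  uniform distance turns them into a base. One direction is an induction over the generation of open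
  sets.\<close>

lemma openin_Met_topology_iff:
  "openin (Met_topology X) U \<longleftrightarrow> U \<subseteq> Met X \<and> (\<forall>d\<in>U. \<exists>r>0. Met_ball X d r \<subseteq> U)"
proof
  assume "openin (Met_topology X) U"
  then have "generate_topology_on {Met_ball X d r | d r. d \<in> Met X \<and> 0 < r} U"
    by (simp add: Met_topology_def openin_topology_generated_by_iff)
  then show "U \<subseteq> Met X \<and> (\<forall>d\<in>U. \<exists>r>0. Met_ball X d r \<subseteq> U)"
  proof induction
    case Empty
    then show ?case by simp
  next
    case (Int A B)
    have "\<exists>r>0. Met_ball X d r \<subseteq> A \<inter> B" if d: "d \<in> A" "d \<in> B" for d
    proof -
      obtain r s where rs: "r > 0" "Met_ball X d r \<subseteq> A" "s > 0" "Met_ball X d s \<subseteq> B"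
        using d Int by meson
      have "Met_ball X d (min r s) \<subseteq> Met_ball X d r \<inter> Met_ball X d s"
        by (auto simp: mem_Met_ball_iff)
      then show ?thesis using rs by (intro exI[of _ "min r s"]) auto
    qed
    then show ?case using Int by auto
  next
    case (UN K)
    then show ?case by (meson Sup_le_iff Sup_upper UnionE subset_trans)
  next
    case (Basis B)
    then obtain d r where B: "B = Met_ball X d r" by blast
    have "\<exists>s>0. Met_ball X e s \<subseteq> B" if "e \<in> B" for e
    proof -
      obtain t where t: "t < r" "\<And>x y. x \<in> topspace X \<Longrightarrow> y \<in> topspace X \<Longrightarrow> \<bar>d x y - e x y\<bar> \<le> t"
        "t \<ge> 0"
        using \<open>e \<in> B\<close> unfolding B mem_Met_ball_iff by blast
      \<comment> \<open>The radius is the slack left by \<open>t\<close>: errors of at most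
        \<open>t\<close> and \<open>u < r - t\<close> add up to less than \<open>r\<close>.\<close>
      have "g \<in> B" if g: "g \<in> Met_ball X e (r - t)" for g
      proof -
        obtain u where u: "u < r - t" "u \<ge> 0" "g \<in> Met X"
          "\<And>x y. x \<in> topspace X \<Longrightarrow> y \<in> topspace X \<Longrightarrow> \<bar>e x y - g x y\<bar> \<le> u"
          using g unfolding mem_Met_ball_iff by blast
        have "\<bar>d x y - g x y\<bar> \<le> t + u" if "x \<in> topspace X" "y \<in> topspace X" for x y
          using t(2)[OF that] u(4)[OF that] by linarith
        then show ?thesis unfolding B mem_Met_ball_iff using t u
          by (intro conjI exI[of _ "t + u"]) auto
      qed
      then show ?thesis using t(1) by (intro exI[of _ "r - t"]) auto
    qed
    moreover have "B \<subseteq> Met X" by (auto simp: B Met_ball_def)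
    ultimately show ?case by blast
  qed
next
  assume U: "U \<subseteq> Met X \<and> (\<forall>d\<in>U. \<exists>r>0. Met_ball X d r \<subseteq> U)"
  have "\<exists>T. openin (Met_topology X) T \<and> d \<in> T \<and> T \<subseteq> U" if d: "d \<in> U" for d
  proof -
    obtain r where r: "r > 0" "Met_ball X d r \<subseteq> U" using U d by blast
    have dX: "d \<in> Met X" using U d by blast
    then have "d \<in> Met_ball X d r" using r(1) unfolding mem_Met_ball_iff
      by (intro conjI exI[of _ 0]) auto
    moreover have "openin (Met_topology X) (Met_ball X d r)"
      unfolding Met_topology_def using r(1) dX by (intro topology_generated_by_Basis) blast
    ultimately show ?thesis using r(2) by blast
  qed
  then show "openin (Met_topology X) U" using openin_subopen by blast
qed

lemma topspace_Met_topology: "topspace (Met_topology X) = Met X"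
proof
  show "topspace (Met_topology X) \<subseteq> Met X"
    using openin_Met_topology_iff[of X "topspace (Met_topology X)"] by simp
  have "openin (Met_topology X) (Met X)"
    unfolding openin_Met_topology_iff by (auto simp: mem_Met_ball_iff intro: exI[of _ 1])
  then show "Met X \<subseteq> topspace (Met_topology X)" by (rule openin_subset)
qed

section \<open>Metrics with a gap in their values: openness and density\<close>

text \<open>The condition \<open>0 \<le> a\<close> gives the gap its content, since every metric
  omits all intervals of negative reals.\<close>

definition gap_metrics :: "'a topology \<Rightarrow> ('a \<Rightarrow> 'a \<Rightarrow> real) set" where
  "gap_metrics X = {d \<in> Met X. \<exists>a b. 0 \<le> a \<and> a < b \<and>
     (\<forall>x\<in>topspace X. \<forall>y\<in>topspace X. d x y \<notin> {a<..<b})}"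

lemma openin_gap_metrics: "openin (Met_topology X) (gap_metrics X)"
  unfolding openin_Met_topology_iff
proof (intro conjI ballI)
  show "gap_metrics X \<subseteq> Met X" by (auto simp: gap_metrics_def)
  fix d assume "d \<in> gap_metrics X"
  then obtain a b where ab: "0 \<le> a" "a < b"
    "\<And>x y. x \<in> topspace X \<Longrightarrow> y \<in> topspace X \<Longrightarrow> d x y \<notin> {a<..<b}"
    by (auto simp: gap_metrics_def)
  \<comment> \<open>A change of less than a quarter of the gap leaves its middle half free of
    values.\<close>
  define q where "q = (b - a) / 4"
  have q: "q > 0" "a + q < b - q" using ab by (auto simp: q_def field_simps)
  have "e \<in> gap_metrics X" if e: "e \<in> Met_ball X d q" for e
  proof -
    have "e x y \<notin> {a + q<..<b - q}" if "x \<in> topspace X" "y \<in> topspace X" for x y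
    proof -
      have "\<bar>d x y - e x y\<bar> < q" using e that unfolding mem_Met_ball_iff by force
      then show ?thesis using ab(3)[OF that] by auto
    qed
    moreover have "0 \<le> a + q" using q ab(1) by simp
    moreover have "e \<in> Met X" using e by (simp add: mem_Met_ball_iff)
    ultimately show ?thesis using q(2) unfolding gap_metrics_def by blast
  qed
  then show "\<exists>r>0. Met_ball X d r \<subseteq> gap_metrics X" using q by blast
qed

text \<open>Ceilings are monotone and subadditive. This yields the triangle inequality for the
  rounded distances between fibres.\<close>

lemma round_up_subadditive:
  fixes h a b c :: real
  assumes "0 < h" "a \<le> b + c"
  shows "h * \<lceil>a / h\<rceil> \<le> h * \<lceil>b / h\<rceil> + h * \<lceil>c / h\<rceil>"
proof -
  have "a / h \<le> b / h + c / h" using assms by (simp add: field_simps)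
  then have "\<lceil>a / h\<rceil> \<le> \<lceil>b / h\<rceil> + \<lceil>c / h\<rceil>"
    using ceiling_mono ceiling_add_le order_trans by blast
  then have "real_of_int \<lceil>a / h\<rceil> \<le> \<lceil>b / h\<rceil> + \<lceil>c / h\<rceil>" by linarith
  then show ?thesis using assms(1) by (metis distrib_left mult_left_mono less_imp_le of_int_add)
qed

lemma round_up_bounds:
  fixes h a :: real
  assumes "0 < h"
  shows "a \<le> h * \<lceil>a / h\<rceil>" "h * \<lceil>a / h\<rceil> < a + h"
proof -
  have "a / h \<le> \<lceil>a / h\<rceil>" "\<lceil>a / h\<rceil> - 1 < a / h" by linarith+
  then show "a \<le> h * \<lceil>a / h\<rceil>" "h * \<lceil>a / h\<rceil> < a + h"
    unfolding pos_divide_le_eq[OF assms] pos_less_divide_eq[OF assms]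
    by (simp_all add: algebra_simps)
qed

lemma gap_metrics_dense:
  assumes X: "strongly_zero_dimensional X" and dX: "d \<in> Met X" and r: "0 < r"
  shows "\<exists>e \<in> gap_metrics X. e \<in> Met_ball X d r"
proof -
  define M where "M = topspace X"
  interpret Metric_space M d using dX by (simp add: Met_def M_def)
  have top: "mtopology = X" using dX by (simp add: Met_def M_def)
  \<comment> \<open>A quarter of \<open>r\<close> suffices because distances change by at most
    \<open>3 * h\<close>: replacing both points by their images under \<open>f\<close> costs
    \<open>2 * h\<close>, and rounding up costs one more \<open>h\<close>.\<close>
  define h where "h = r / 4"
  have h: "h > 0" using r by (simp add: h_def)
  obtain f where fM: "\<And>x. x \<in> M \<Longrightarrow> f x \<in> M" and fd: "\<And>x. x \<in> M \<Longrightarrow> d (f x) x < h"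
    and floc: "\<And>x. x \<in> M \<Longrightarrow> \<exists>\<delta>>0. \<forall>y\<in>mball x \<delta>. f y = f x"
    using locally_constant_approximation[OF X[folded top] h] by blast
  define D where "D x y = h * \<lceil>d (f x) (f y) / h\<rceil>" for x y
  \<comment> \<open>Values inside a fibre of \<open>f\<close> are at most \<open>h / 2\<close>, and
    those between fibres are at least \<open>h\<close>. The value \<open>0\<close> off
    \<open>M\<close> is the convention built into \<open>Met\<close>.\<close>
  define e where "e x y = (if x \<notin> M \<or> y \<notin> M then 0
    else if f x = f y then min (d x y) (h / 2) else D x y)" for x y
  have Dh: "h \<le> D x y" if "x \<in> M" "y \<in> M" "f x \<noteq> f y" for x y
  proof -
    have "0 < d (f x) (f y)" using that fM by simp
    then have "1 \<le> \<lceil>d (f x) (f y) / h\<rceil>" using h by simp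
    then have "1 \<le> real_of_int \<lceil>d (f x) (f y) / h\<rceil>" by linarith
    then show ?thesis using h unfolding D_def by (metis mult_left_mono less_imp_le mult.right_neutral)
  qed
  have e: "Metric_space M e"
  proof
    show "0 \<le> e x y" for x y
      using Dh[of x y] h by (auto simp: e_def)
    show "e x y = e y x" for x y
      by (auto simp: e_def D_def commute)
    show "e x y = 0 \<longleftrightarrow> x = y" if "x \<in> M" "y \<in> M" for x y
      using Dh[OF that] h that by (auto simp: e_def min_def)
    show "e x z \<le> e x y + e y z" if xyz: "x \<in> M" "y \<in> M" "z \<in> M" for x y z
    proof -
      have t: "d x z \<le> d x y + d y z" using xyz triangle by blast
      have T: "D x z \<le> D x y + D y z"
        unfolding D_def using xyz fM h by (intro round_up_subadditive) (auto intro: triangle)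
      have D1: "D x z = D y z" if "f x = f y" using that by (simp add: D_def)
      have D2: "D x z = D x y" if "f y = f z" using that by (simp add: D_def)
      have n: "0 \<le> d x y" "0 \<le> d y z" by auto
      \<comment> \<open>In a single fibre this is the triangle inequality for a truncated metric;
        for three fibres it is \<open>T\<close>. If \<open>y\<close> shares its fibre with just one
        of \<open>x\<close>, \<open>z\<close>, then \<open>D1\<close> or \<open>D2\<close> applies,
        as \<open>D\<close> depends only on fibres. If only \<open>x\<close> and \<open>z\<close>
        share one, the left side is at most \<open>h / 2\<close> and the right side at least
        \<open>2 * h\<close>.\<close>
      show ?thesis
        using Dh[of x y] Dh[of y z] h t T D1 D2 xyz n
        by (cases "f x = f y"; cases "f y = f z"; cases "f x = f z") (auto simp: e_def min_def simp del: nonneg)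
    qed
  qed
  have "mtopology = Metric_space.mtopology M e"
  proof (rule mtopology_eq_if_locally_agree[OF Metric_space_axioms e])
    fix x assume x: "x \<in> M"
    obtain \<delta> where \<delta>: "\<delta> > 0" "\<And>y. y \<in> mball x \<delta> \<Longrightarrow> f y = f x" using floc[OF x] by blast
    \<comment> \<open>Below \<open>h / 2\<close> the truncation is invisible inside the fibre of
      \<open>x\<close>, while points of other fibres are at distance at least
      \<open>\<delta>\<close> in \<open>d\<close> and at least \<open>h\<close> in
      \<open>e\<close>.\<close>
    have "d x y < s \<longleftrightarrow> e x y < s" if s: "s \<le> min \<delta> (h / 2)" and y: "y \<in> M" for s y
    proof (cases "f x = f y")
      case True
      then show ?thesis using s x y by (auto simp: e_def)
    next
      case False
      then have "\<not> d x y < s" using \<delta>(2)[of y] s x y by auto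
      moreover have "\<not> e x y < s" using False Dh[of x y] s x y h by (auto simp: e_def)
      ultimately show ?thesis by simp
    qed
    then show "\<exists>\<delta>>0. \<forall>s\<le>\<delta>. \<forall>y\<in>M. d x y < s \<longleftrightarrow> e x y < s"
      using \<delta>(1) h by (intro exI[of _ "min \<delta> (h / 2)"]) auto
  qed
  then have "Metric_space.mtopology M e = X" using top by simp
  then have eX: "e \<in> Met X"
    using e unfolding Met_def mem_Collect_eq M_def[symmetric] by (auto simp: e_def)
  have "e x y \<notin> {h / 2<..<h}" if "x \<in> M" "y \<in> M" for x y
    using Dh[OF that] by (auto simp: e_def)
  moreover have "0 \<le> h / 2" "h / 2 < h" using h by auto
  ultimately have "e \<in> gap_metrics X"
    using eX unfolding gap_metrics_def M_def[symmetric] by blast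
  moreover have "\<bar>d x y - e x y\<bar> \<le> 3 * h" if xy: "x \<in> M" "y \<in> M" for x y
  proof -
    have 1: "\<bar>d x y - d (f x) (f y)\<bar> \<le> 2 * h"
    proof -
      have "d x y \<le> d x (f x) + d (f x) y" "d (f x) y \<le> d (f x) (f y) + d (f y) y"
        "d (f x) (f y) \<le> d (f x) x + d x (f y)" "d x (f y) \<le> d x y + d y (f y)"
        using xy fM triangle by blast+
      then show ?thesis using fd[OF xy(1)] fd[OF xy(2)] commute[of x "f x"] commute[of y "f y"]
        by linarith
    qed
    show ?thesis
    proof (cases "f x = f y")
      case True
      then have "d x y \<le> 2 * h" using 1 xy fM by simp
      then show ?thesis using True xy h nonneg[of x y] by (auto simp: e_def min_def)
    next
      case False
      then show ?thesis
        using 1 round_up_bounds[OF h, of "d (f x) (f y)"] xy by (auto simp: e_def D_def)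
    qed
  qed
  then have "e \<in> Met_ball X d r" using eX h unfolding mem_Met_ball_iff M_def[symmetric]
    by (intro conjI exI[of _ "3 * h"]) (auto simp: h_def)
  ultimately show ?thesis by blast
qed

section \<open>Meagerness from an open dense complement\<close>

text \<open>An open set disjoint from \<open>S\<close> is also disjoint from its closure, and
  density of the gap metrics then leaves that closure without interior. So \<open>S\<close> is
  itself nowhere dense, and a constant sequence witnesses meagerness.\<close>

lemma meager_in_if_avoids_gap_metrics:
  assumes X: "strongly_zero_dimensional X" and S: "S \<subseteq> Met X" "S \<inter> gap_metrics X = {}"
  shows "meager_in (Met_topology X) S"
proof -
  let ?T = "Met_topology X"
  have "?T closure_of S \<inter> gap_metrics X = {}"
    using openin_Int_closure_of_eq_empty[OF openin_gap_metrics, of X S] S(2) by blast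
  moreover have "\<exists>g\<in>gap_metrics X. g \<in> ?T interior_of (?T closure_of S)"
    if d: "d \<in> ?T interior_of (?T closure_of S)" for d
  proof -
    have "openin ?T (?T interior_of (?T closure_of S))" by simp
    then obtain r where "r > 0" "Met_ball X d r \<subseteq> ?T interior_of (?T closure_of S)" "d \<in> Met X"
      using d unfolding openin_Met_topology_iff by blast
    then show ?thesis using gap_metrics_dense[OF X] by blast
  qed
  ultimately have "?T interior_of (?T closure_of S) = {}"
    using interior_of_subset[of ?T "?T closure_of S"] by blast
  then have "nowhere_dense_in ?T S"
    using S(1) by (simp add: nowhere_dense_in_def topspace_Met_topology)
  then show ?thesis unfolding meager_in_def by (intro exI[of _ "\<lambda>_. S"]) auto
qed

section \<open>Two-point spaces and the distances they force\<close>

definition two_point :: "real \<Rightarrow> nat \<Rightarrow> nat \<Rightarrow> real" where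
  "two_point s i j = (if i = j then 0 else s)"

lemma ultrametric_on_two_point: "0 < s \<Longrightarrow> ultrametric_on A (two_point s)"
  by (auto simp: ultrametric_on_def two_point_def Metric_space_def)

lemma dist_attained_if_two_point_embeds:
  assumes "isometric_embedding {0, 1} (two_point s) M d \<phi>"
  shows "\<exists>x\<in>M. \<exists>y\<in>M. d x y = s"
  using assms by (auto simp: isometric_embedding_def two_point_def)

text \<open>The midpoint of a gap would be a limit of \<open>R\<close>, so some element of
  \<open>R\<close> would lie inside the gap and be attained. Such an element is positive because the
  gap starts at \<open>a \<ge> 0\<close>.\<close>

lemma not_gap_metric_if_attains_dense:
  assumes "{0..} \<subseteq> closure R" and "\<And>s. s \<in> R \<Longrightarrow> 0 < s \<Longrightarrow> \<exists>x\<in>topspace X. \<exists>y\<in>topspace X. d x y = s"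
  shows "d \<notin> gap_metrics X"
proof
  assume "d \<in> gap_metrics X"
  then obtain a b where ab: "0 \<le> a" "a < b"
    "\<forall>x\<in>topspace X. \<forall>y\<in>topspace X. d x y \<notin> {a<..<b}"
    by (auto simp: gap_metrics_def)
  have "(a + b) / 2 \<in> closure R" "(a + b) / 2 \<in> {a<..<b}" using ab assms(1) by auto
  then have "{a<..<b} \<inter> R \<noteq> {}"
    using open_Int_closure_eq_empty[OF open_greaterThanLessThan, of a b R] by blast
  then obtain s where "s \<in> R" "a < s" "s < b" by auto
  then show False using ab assms(2)[of s] by fastforce
qed

theorem corollary3p12:
  fixes X :: "'a topology" and R :: "real set"
  assumes "metrizable_space X"
    and "strongly_zero_dimensional X"
    and "R \<subseteq> {0..}" and "{0..} \<subseteq> closure R" and "0 \<in> R"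
  shows "meager_in (Met_topology X)
           {d \<in> Met X. universal_for finite_metric_spaces (topspace X) d}
       \<and> meager_in (Met_topology X)
           {d \<in> Met X. ultrametric_on (topspace X) d \<and>
              injective_for (finite_ultrametric_spaces R) (topspace X) d}"
proof (intro conjI meager_in_if_avoids_gap_metrics[OF assms(2)])
  have "d \<notin> gap_metrics X" if d: "universal_for finite_metric_spaces (topspace X) d" for d
  proof (rule not_gap_metric_if_attains_dense[OF assms(4)])
    fix s :: real assume "0 < s"
    then have "({0, 1}, two_point s) \<in> finite_metric_spaces"
      using ultrametric_on_two_point[of s] by (auto simp: finite_metric_spaces_def ultrametric_on_def)
    then show "\<exists>x\<in>topspace X. \<exists>y\<in>topspace X. d x y = s"
      using d dist_attained_if_two_point_embeds unfolding universal_for_def by fast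
  qed
  then show "{d \<in> Met X. universal_for finite_metric_spaces (topspace X) d} \<inter> gap_metrics X = {}"
    by blast
  have "d \<notin> gap_metrics X"
    if d: "injective_for (finite_ultrametric_spaces R) (topspace X) d" for d
  proof (rule not_gap_metric_if_attains_dense[OF assms(4)])
    fix s assume "s \<in> R" "0 < s"
    then have "({0, 1}, two_point s) \<in> finite_ultrametric_spaces R"
      \<comment> \<open>The diagonal values of the two-point space are covered by
        \<open>0 \<in> R\<close>.\<close>
      using ultrametric_on_two_point[of s] assms(5)
      by (auto simp: finite_ultrametric_spaces_def two_point_def)
    \<comment> \<open>Injectivity is applied to the empty subspace: extending the empty map places a
      pair at distance \<open>s\<close>. Since no value of the map is inspected,
      \<open>undefined\<close> serves.\<close>
    moreover have "isometric_embedding {} (two_point s) (topspace X) d undefined"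
      by (simp add: isometric_embedding_def)
    ultimately obtain \<Phi> where "isometric_embedding {0, 1} (two_point s) (topspace X) d \<Phi>"
      using d unfolding injective_for_def by blast
    then show "\<exists>x\<in>topspace X. \<exists>y\<in>topspace X. d x y = s"
      by (rule dist_attained_if_two_point_embeds)
  qed
  then show "{d \<in> Met X. ultrametric_on (topspace X) d \<and>
      injective_for (finite_ultrametric_spaces R) (topspace X) d} \<inter> gap_metrics X = {}"
    by blast
qed auto

end
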